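(* Let $L_1,\ldots,L_r$ be bounded lattices. Then the product lattice $L_1\times L_2\times\cdots\times L_r$ is complemented if and only if each of $L_1,\ldots,L_r$ is complemented.
   Context: The product $L_1\times\cdots\times L_r$ of lattices carries the componentwise partial order: $(x_1,\dots,x_r)\le(y_1,\dots,y_r)$ if and only if $x_i\le y_i$ in $L_i$ for all $i$; it is a lattice. In a bounded lattice $L$ with minimum $\hat 0$ and maximum $\hat 1$, an element $y$ is a complement of $x$ if $x\wedge y=\hat 0$ and $x\vee y=\hat 1$; $L$ is complemented if every element of $L$ has a complement. *)

theory Defs
  imports "HOL-Algebra.Lattice" "HOL-Library.FuncSet"
begin

definition is_complement :: "('a, 'b) gorder_scheme \<Rightarrow> 'a \<Rightarrow> 'a \<Rightarrow> bool" where
  "is_complement L x y \<longleftrightarrow>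
     x \<in> carrier L \<and> y \<in> carrier L \<and> x \<sqinter>\<^bsub>L\<^esub> y = \<bottom>\<^bsub>L\<^esub> \<and> x \<squnion>\<^bsub>L\<^esub> y = \<top>\<^bsub>L\<^esub>"

locale complemented_lattice = bounded_lattice +
  assumes complement_exists: "x \<in> carrier L \<Longrightarrow> \<exists>y. is_complement L x y"

text \<open>
  Tuples indexed by \<open>I\<close> are the extensional functions on \<open>I\<close>, so that equality of
  functions is componentwise equality.  The order \<open>le\<close> only matters on the carrier.
\<close>

definition product_order :: "'i set \<Rightarrow> ('i \<Rightarrow> ('a, 'b) gorder_scheme) \<Rightarrow> ('i \<Rightarrow> 'a) gorder" where
  "product_order I L =
     \<lparr> carrier = (\<Pi>\<^sub>E i\<in>I. carrier (L i)),
       eq = (=),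
       le = (\<lambda>x y. \<forall>i\<in>I. x i \<sqsubseteq>\<^bsub>L i\<^esub> y i) \<rparr>"

end

theory Submission
  imports Defs
begin

text \<open>
  Since the order of the product is componentwise, so are its least and greatest elements and
  the meets and joins of pairs: the tuple of the values of these operations in the factors has
  the universal property that determines the operation in the product.  Hence \<open>y\<close> is a
  complement of \<open>x\<close> in the product exactly when each \<open>y i\<close> is a complement of \<open>x i\<close>
  (lemma \<open>is_complement_product_iff\<close>).

  If every factor is complemented, then choosing a complement of each component of \<open>x\<close> gives a
  complement of \<open>x\<close>.  Conversely, to find a complement of an element \<open>a\<close> of the
  factor \<open>L i\<close>, put \<open>a\<close> into the \<open>i\<close>-th place of some tuple; the bottom tuple serves, because
  every factor is bounded.  The \<open>i\<close>-th component of a complement of this tuple is a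
  complement of \<open>a\<close>.
\<close>

lemma carrier_product_order [simp]: "carrier (product_order I L) = (\<Pi>\<^sub>E i\<in>I. carrier (L i))"
  by (simp add: product_order_def)

lemma eq_product_order [simp]: "eq (product_order I L) = (=)"
  by (simp add: product_order_def)

lemma le_product_order_iff [simp]:
  "x \<sqsubseteq>\<^bsub>product_order I L\<^esub> y \<longleftrightarrow> (\<forall>i\<in>I. x i \<sqsubseteq>\<^bsub>L i\<^esub> y i)"
  by (simp add: product_order_def)

text \<open>
  The operations are defined by choice of some least or greatest bound.  When \<open>eq\<close> is
  equality, antisymmetry leaves only one candidate.
\<close>

lemma (in upper_semilattice) join_eqI:
  assumes "x \<in> carrier L" "y \<in> carrier L" "least L s (Upper L {x, y})"
  shows "x \<squnion> y = s"
  unfolding join_def using sup_of_two_least[OF assms(1,2)] assms(3) by (rule least_unique)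

lemma (in lower_semilattice) meet_eqI:
  assumes "x \<in> carrier L" "y \<in> carrier L" "greatest L s (Lower L {x, y})"
  shows "x \<sqinter> y = s"
  unfolding meet_def using inf_of_two_greatest[OF assms(1,2)] assms(3) by (rule greatest_unique)

locale bounded_lattice_family =
  fixes I :: "'i set" and L :: "'i \<Rightarrow> ('a, 'b) gorder_scheme"
  assumes bounded_factor: "i \<in> I \<Longrightarrow> bounded_lattice (L i)"
begin

abbreviation P :: "('i \<Rightarrow> 'a) gorder" where
  "P \<equiv> product_order I L"

text \<open>
  \<open>L i\<close> is known to be a lattice only for \<open>i \<in> I\<close>, so the laws of the factors are collected as rules
  conditional on \<open>i \<in> I\<close>; as such they apply below the quantifier over \<open>i\<close> in the product order.
\<close>

lemma le_antisym_factor: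
  assumes "i \<in> I" "a \<in> carrier (L i)" "b \<in> carrier (L i)" "a \<sqsubseteq>\<^bsub>L i\<^esub> b" "b \<sqsubseteq>\<^bsub>L i\<^esub> a"
  shows "a = b"
proof -
  interpret bounded_lattice "L i"
    using assms(1) by (rule bounded_factor)
  show ?thesis
    using assms by (blast intro: le_antisym)
qed

lemma factor_locales:
  assumes "i \<in> I"
  shows "weak_partial_order (L i)" "weak_upper_semilattice (L i)" "weak_lower_semilattice (L i)"
    "weak_partial_order_bottom (L i)" "weak_partial_order_top (L i)"
proof -
  interpret bounded_lattice "L i"
    using assms by (rule bounded_factor)
  show "weak_partial_order (L i)" "weak_upper_semilattice (L i)" "weak_lower_semilattice (L i)"
    "weak_partial_order_bottom (L i)" "weak_partial_order_top (L i)"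
    by unfold_locales
qed

lemmas factor_refl = weak_partial_order.le_refl[OF factor_locales(1)]
lemmas factor_trans = weak_partial_order.le_trans[OF factor_locales(1)]

lemmas factor_join =
  weak_upper_semilattice.join_closed[OF factor_locales(2)]
  weak_upper_semilattice.join_left[OF factor_locales(2)]
  weak_upper_semilattice.join_right[OF factor_locales(2)]
  weak_upper_semilattice.join_le[OF factor_locales(2)]

lemmas factor_meet =
  weak_lower_semilattice.meet_closed[OF factor_locales(3)]
  weak_lower_semilattice.meet_left[OF factor_locales(3)]
  weak_lower_semilattice.meet_right[OF factor_locales(3)]
  weak_lower_semilattice.meet_le[OF factor_locales(3)]

lemmas factor_bottom =
  weak_partial_order_bottom.bottom_closed[OF factor_locales(4)]
  weak_partial_order_bottom.bottom_lower[OF factor_locales(4)]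

lemmas factor_top =
  weak_partial_order_top.top_closed[OF factor_locales(5)]
  weak_partial_order_top.top_higher[OF factor_locales(5)]

text \<open>
  Antisymmetry is the place where extensionality matters: tuples that agree on \<open>I\<close> are equal.
\<close>

lemma partial_order_product: "partial_order P"
proof
  fix x y assume le: "x \<sqsubseteq>\<^bsub>P\<^esub> y" "y \<sqsubseteq>\<^bsub>P\<^esub> x" and P: "x \<in> carrier P" "y \<in> carrier P"
  have "x i = y i" if "i \<in> I" for i
    using le P that by (intro le_antisym_factor) (auto simp: PiE_iff)
  with P show "x .=\<^bsub>P\<^esub> y"
    by (auto intro: PiE_ext)
next
  fix x y z
  assume "x \<sqsubseteq>\<^bsub>P\<^esub> y" "y \<sqsubseteq>\<^bsub>P\<^esub> z" "x \<in> carrier P" "y \<in> carrier P" "z \<in> carrier P"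
  then show "x \<sqsubseteq>\<^bsub>P\<^esub> z"
    by (auto simp: PiE_iff intro: factor_trans[where y = "y _"])
qed (auto simp: PiE_iff factor_refl)

lemma least_product_join:
  assumes "x \<in> carrier P" "y \<in> carrier P"
  shows "least P (\<lambda>i\<in>I. x i \<squnion>\<^bsub>L i\<^esub> y i) (Upper P {x, y})"
  using assms by (auto simp: least_def Upper_def PiE_iff factor_join)

lemma greatest_product_meet:
  assumes "x \<in> carrier P" "y \<in> carrier P"
  shows "greatest P (\<lambda>i\<in>I. x i \<sqinter>\<^bsub>L i\<^esub> y i) (Lower P {x, y})"
  using assms by (auto simp: greatest_def Lower_def PiE_iff factor_meet)

lemma least_product_bottom: "least P (\<lambda>i\<in>I. \<bottom>\<^bsub>L i\<^esub>) (carrier P)"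
  by (auto simp: least_def PiE_iff factor_bottom)

lemma greatest_product_top: "greatest P (\<lambda>i\<in>I. \<top>\<^bsub>L i\<^esub>) (carrier P)"
  by (auto simp: greatest_def PiE_iff factor_top)

sublocale product: bounded_lattice P
proof -
  interpret partial_order P
    by (rule partial_order_product)
  show "bounded_lattice P"
    using least_product_join greatest_product_meet least_product_bottom greatest_product_top
    by unfold_locales blast+
qed

lemma join_product:
  assumes "x \<in> carrier P" "y \<in> carrier P"
  shows "x \<squnion>\<^bsub>P\<^esub> y = (\<lambda>i\<in>I. x i \<squnion>\<^bsub>L i\<^esub> y i)"
  using assms least_product_join by (intro product.join_eqI)

lemma meet_product:
  assumes "x \<in> carrier P" "y \<in> carrier P"
  shows "x \<sqinter>\<^bsub>P\<^esub> y = (\<lambda>i\<in>I. x i \<sqinter>\<^bsub>L i\<^esub> y i)"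
  using assms greatest_product_meet by (intro product.meet_eqI)

lemma bottom_product: "\<bottom>\<^bsub>P\<^esub> = (\<lambda>i\<in>I. \<bottom>\<^bsub>L i\<^esub>)"
  by (rule product.least_unique[OF product.bottom_least least_product_bottom])

lemma top_product: "\<top>\<^bsub>P\<^esub> = (\<lambda>i\<in>I. \<top>\<^bsub>L i\<^esub>)"
  by (rule product.greatest_unique[OF product.top_greatest greatest_product_top])

text \<open>
  Both equations that define a complement are equations between tuples, and those hold exactly
  when they hold at every index.
\<close>

lemma is_complement_product_iff:
  assumes "x \<in> carrier P" "y \<in> carrier P"
  shows "is_complement P x y \<longleftrightarrow> (\<forall>i\<in>I. is_complement (L i) (x i) (y i))"
proof -
  have restrict_eq_iff: "restrict f I = restrict g I \<longleftrightarrow> (\<forall>i\<in>I. f i = g i)" for f g :: "'i \<Rightarrow> 'a"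
    by (metis restrict_apply' restrict_ext)
  have "is_complement P x y \<longleftrightarrow> (\<lambda>i\<in>I. x i \<sqinter>\<^bsub>L i\<^esub> y i) = (\<lambda>i\<in>I. \<bottom>\<^bsub>L i\<^esub>) \<and>
      (\<lambda>i\<in>I. x i \<squnion>\<^bsub>L i\<^esub> y i) = (\<lambda>i\<in>I. \<top>\<^bsub>L i\<^esub>)"
    using assms unfolding is_complement_def
    by (simp only: join_product meet_product bottom_product top_product simp_thms)
  also have "\<dots> \<longleftrightarrow> (\<forall>i\<in>I. is_complement (L i) (x i) (y i))"
    using assms by (auto simp: restrict_eq_iff is_complement_def PiE_mem)
  finally show ?thesis .
qed

lemma complemented_lattice_product:
  assumes "\<forall>i\<in>I. complemented_lattice (L i)"
  shows "complemented_lattice P"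
proof
  fix x assume x: "x \<in> carrier P"
  then have "\<forall>i\<in>I. \<exists>c. is_complement (L i) (x i) c"
    using assms complemented_lattice.complement_exists by (fastforce simp: PiE_mem)
  then obtain c where c: "\<forall>i\<in>I. is_complement (L i) (x i) (c i)"
    by metis
  then have "restrict c I \<in> carrier P"
    by (auto simp: is_complement_def)
  with x c have "is_complement P x (restrict c I)"
    by (simp only: is_complement_product_iff) simp
  then show "\<exists>y. is_complement P x y"
    by blast
qed

lemma complemented_lattice_factor:
  assumes "complemented_lattice P" and i: "i \<in> I"
  shows "complemented_lattice (L i)"
proof (intro complemented_lattice.intro complemented_lattice_axioms.intro)
  fix a assume "a \<in> carrier (L i)"
  \<comment> \<open>Any tuple through \<open>a\<close> would do; the bottom tuple supplies the other components.\<close>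
  then have x: "\<bottom>\<^bsub>P\<^esub>(i := a) \<in> carrier P"
    using i product.bottom_closed by (auto simp: PiE_iff extensional_def)
  from complemented_lattice.complement_exists[OF assms(1) x]
  obtain y where y: "is_complement P (\<bottom>\<^bsub>P\<^esub>(i := a)) y"
    by (rule exE)
  then have "y \<in> carrier P"
    unfolding is_complement_def by (elim conjE)
  with x have "\<forall>j\<in>I. is_complement (L j) ((\<bottom>\<^bsub>P\<^esub>(i := a)) j) (y j)"
    using y by (simp only: is_complement_product_iff)
  from bspec[OF this i] have "is_complement (L i) a (y i)"
    by simp
  then show "\<exists>b. is_complement (L i) a b" ..
qed (rule bounded_factor[OF i])

end

theorem proposition3p18:
  fixes r :: nat and L :: "nat \<Rightarrow> ('a, 'b) gorder_scheme"
  assumes "\<And>i. i \<in> {1..r} \<Longrightarrow> bounded_lattice (L i)"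
  shows "complemented_lattice (product_order {1..r} L) \<longleftrightarrow>
         (\<forall>i\<in>{1..r}. complemented_lattice (L i))"
proof -
  interpret bounded_lattice_family "{1..r}" L
    using assms by (rule bounded_lattice_family.intro)
  show ?thesis
    using complemented_lattice_product complemented_lattice_factor by blast
qed

end
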